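(* Let $V=\mathbb{R}^2$ and let $(v_{i,j})_{1\leq i<j\leq 4}\in V^6$ be a collection of six vectors in $\mathbb{R}^2$. Then the following are equivalent: (a) $det^{S^2}\big((v_{i,j})_{1\leq i<j\leq 4}\big)=0$. (b) There exist points $Q_1,Q_2,Q_3,Q_4$ in the plane $\mathbb{R}^2$ and scalars $\lambda_{i,j}\in\mathbb{R}$ for $1\leq i<j\leq 4$, not all zero, such that $\lambda_{i,j}v_{i,j}=\overrightarrow{Q_iQ_j}$ for all $1\leq i<j\leq 4$.
   Context: Elements of $V^6$ are indexed by pairs $1\leq i<j\leq 4$ and written $(v_{i,j})_{1\leq i<j\leq 4}$. For points $P,Q\in\mathbb{R}^2$, $\overrightarrow{PQ}=Q-P$. The map $det^{S^2}:(\mathbb{R}^2)^6\to \mathbb{R}$ is defined, for $v_{i,j}=(\alpha_{i,j},\beta_{i,j})\in \mathbb{R}^2$, by $$\begin{aligned} det^{S^2}\big((v_{i,j})_{1\leq i<j\leq 4}\big)=\;&\alpha_{1,2}\alpha_{2,3}\alpha_{3,4}\beta_{1,3}\beta_{2,4}\beta_{1,4}+\alpha_{1,2}\beta_{2,3}\alpha_{3,4}\beta_{1,3}\beta_{2,4}\alpha_{1,4}+\alpha_{1,2}\beta_{2,3}\beta_{3,4}\alpha_{1,3}\alpha_{2,4}\beta_{1,4}\\ &+\beta_{1,2}\beta_{2,3}\alpha_{3,4}\alpha_{1,3}\alpha_{2,4}\beta_{1,4}+\beta_{1,2}\alpha_{2,3}\beta_{3,4}\beta_{1,3}\alpha_{2,4}\alpha_{1,4}+\beta_{1,2}\alpha_{2,3}\beta_{3,4}\alpha_{1,3}\beta_{2,4}\alpha_{1,4}\\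 &-\beta_{1,2}\beta_{2,3}\beta_{3,4}\alpha_{1,3}\alpha_{2,4}\alpha_{1,4}-\beta_{1,2}\alpha_{2,3}\beta_{3,4}\alpha_{1,3}\alpha_{2,4}\beta_{1,4}-\beta_{1,2}\alpha_{2,3}\alpha_{3,4}\beta_{1,3}\beta_{2,4}\alpha_{1,4}\\ &-\alpha_{1,2}\alpha_{2,3}\beta_{3,4}\beta_{1,3}\beta_{2,4}\alpha_{1,4}-\alpha_{1,2}\beta_{2,3}\alpha_{3,4}\alpha_{1,3}\beta_{2,4}\beta_{1,4}-\alpha_{1,2}\beta_{2,3}\alpha_{3,4}\beta_{1,3}\alpha_{2,4}\beta_{1,4}. \end{aligned}$$ *)

theory Defs
  imports "HOL-Analysis.Analysis"
begin

text \<open>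
  A family (v_{i,j}) with 1 \<le> i < j \<le> 4 in V^6 is represented by a function on pairs of natural numbers;
  only the six values at such index pairs matter.
  The components \<open>v i j $ 1\<close> and \<open>v i j $ 2\<close> are \<open>\<alpha>\<close> and \<open>\<beta>\<close>, the first and second
  coordinates of \<open>v i j\<close>.
\<close>

definition det_S2 :: "(nat \<Rightarrow> nat \<Rightarrow> real^2) \<Rightarrow> real" where
  "det_S2 v =
       v 1 2 $ 1 * v 2 3 $ 1 * v 3 4 $ 1 * v 1 3 $ 2 * v 2 4 $ 2 * v 1 4 $ 2
     + v 1 2 $ 1 * v 2 3 $ 2 * v 3 4 $ 1 * v 1 3 $ 2 * v 2 4 $ 2 * v 1 4 $ 1
     + v 1 2 $ 1 * v 2 3 $ 2 * v 3 4 $ 2 * v 1 3 $ 1 * v 2 4 $ 1 * v 1 4 $ 2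
     + v 1 2 $ 2 * v 2 3 $ 2 * v 3 4 $ 1 * v 1 3 $ 1 * v 2 4 $ 1 * v 1 4 $ 2
     + v 1 2 $ 2 * v 2 3 $ 1 * v 3 4 $ 2 * v 1 3 $ 2 * v 2 4 $ 1 * v 1 4 $ 1
     + v 1 2 $ 2 * v 2 3 $ 1 * v 3 4 $ 2 * v 1 3 $ 1 * v 2 4 $ 2 * v 1 4 $ 1
     - v 1 2 $ 2 * v 2 3 $ 2 * v 3 4 $ 2 * v 1 3 $ 1 * v 2 4 $ 1 * v 1 4 $ 1
     - v 1 2 $ 2 * v 2 3 $ 1 * v 3 4 $ 2 * v 1 3 $ 1 * v 2 4 $ 1 * v 1 4 $ 2
     - v 1 2 $ 2 * v 2 3 $ 1 * v 3 4 $ 1 * v 1 3 $ 2 * v 2 4 $ 2 * v 1 4 $ 1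
     - v 1 2 $ 1 * v 2 3 $ 1 * v 3 4 $ 2 * v 1 3 $ 2 * v 2 4 $ 2 * v 1 4 $ 1
     - v 1 2 $ 1 * v 2 3 $ 2 * v 3 4 $ 1 * v 1 3 $ 1 * v 2 4 $ 2 * v 1 4 $ 2
     - v 1 2 $ 1 * v 2 3 $ 2 * v 3 4 $ 1 * v 1 3 $ 2 * v 2 4 $ 1 * v 1 4 $ 2"

definition vector_between :: "real^2 \<Rightarrow> real^2 \<Rightarrow> real^2" where
  "vector_between P Q = Q - P"

end

theory Submission
  imports Defs
begin

text \<open>
  Put \<open>Q\<^sub>1\<close> at the origin. A realisation is then given by \<open>Q\<^sub>j = a\<^sub>j v\<^sub>1\<^sub>j\<close> for \<open>j = 2, 3, 4\<close>
  such that each \<open>Q\<^sub>j - Q\<^sub>i\<close> is parallel to \<open>v\<^sub>i\<^sub>j\<close>. Taking planar cross products with \<open>v\<^sub>2\<^sub>3\<close>,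
  \<open>v\<^sub>2\<^sub>4\<close>, \<open>v\<^sub>3\<^sub>4\<close> turns this into a homogeneous linear system for \<open>(a\<^sub>2, a\<^sub>3, a\<^sub>4)\<close>, whose
  determinant is \<open>det_S2 v\<close> up to sign. The degenerate cases, where all \<open>a\<^sub>j\<close> vanish or some
  \<open>v\<^sub>i\<^sub>j\<close> is zero, are handled by the multilinearity of \<open>det_S2\<close>.
\<close>

definition cross2 :: "real^2 \<Rightarrow> real^2 \<Rightarrow> real" where
  "cross2 x y = x $ 1 * y $ 2 - x $ 2 * y $ 1"

lemma cross2_diff_left: "cross2 (x - y) z = cross2 x z - cross2 y z"
  by (simp add: cross2_def algebra_simps)

lemma cross2_scaleR_left: "cross2 (c *\<^sub>R x) z = c * cross2 x z"
  by (simp add: cross2_def algebra_simps)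

lemma cross2_scaleR_self: "cross2 (c *\<^sub>R x) x = 0"
  by (simp add: cross2_def)

text \<open>The factor is the quotient of coordinates at a place where \<open>y\<close> does not
  vanish. For \<open>y = 0\<close> the cross product carries no information, so zero vectors form a
  separate case below.\<close>

lemma parallel_if_cross2_eq_0:
  assumes "cross2 x y = 0" "y \<noteq> 0"
  obtains c where "x = c *\<^sub>R y"
proof -
  from \<open>y \<noteq> 0\<close> consider "y $ 1 \<noteq> 0" | "y $ 2 \<noteq> 0"
    by (auto simp: vec_eq_iff forall_2)
  then show thesis
  proof cases
    case 1
    then have "x = (x $ 1 / y $ 1) *\<^sub>R y"
      using assms(1) by (auto simp: vec_eq_iff forall_2 cross2_def field_simps)
    then show thesis by (rule that)
  next
    case 2
    then have "x = (x $ 2 / y $ 2) *\<^sub>R y"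
      using assms(1) by (auto simp: vec_eq_iff forall_2 cross2_def field_simps)
    then show thesis by (rule that)
  qed
qed

text \<open>Of the 16 monomials on the right, the two in which the three \<open>v 1 j\<close> all
  contribute the same coordinate cancel, leaving the 12 of \<open>det_S2\<close>.\<close>

lemma det_S2_cross2:
  "det_S2 v =
     cross2 (v 1 3) (v 2 3) * cross2 (v 1 2) (v 2 4) * cross2 (v 1 4) (v 3 4)
   - cross2 (v 1 2) (v 2 3) * cross2 (v 1 4) (v 2 4) * cross2 (v 1 3) (v 3 4)"
  unfolding det_S2_def cross2_def by (simp add: algebra_simps)

text \<open>Each equation links only two of the three unknowns, so the determinant of the system has
  just two terms.\<close>

lemma triangular_system_nontrivial_iff:
  fixes p q r s t u :: real
  shows "(\<exists>a b c. (a \<noteq> 0 \<or> b \<noteq> 0 \<or> c \<noteq> 0) \<and> b * p = a * s \<and> c * t = a * q \<and> c * r = b * u)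
    \<longleftrightarrow> p * q * r = s * t * u"
    (is "(\<exists>a b c. ?nz a b c \<and> ?sys a b c) \<longleftrightarrow> _")
proof
  assume "\<exists>a b c. ?nz a b c \<and> ?sys a b c"
  then obtain a b c where nz: "?nz a b c" and eqs: "b * p = a * s" "c * t = a * q" "c * r = b * u"
    by blast
  \<comment> \<open>As in Cramer's rule, the determinant annihilates every unknown.\<close>
  have "a * (p * q * r - s * t * u) = 0" "b * (p * q * r - s * t * u) = 0"
    "c * (p * q * r - s * t * u) = 0"
    using eqs by algebra+
  then show "p * q * r = s * t * u"
    using nz by auto
next
  assume det: "p * q * r = s * t * u"
  \<comment> \<open>The columns of the adjugate solve the system; if they all vanish, a unit vector does.\<close>
  have "?sys (p * t) (s * t) (p * q)" "?sys (r * p) (r * s) (u * s)" "?sys (t * u) (r * q) (u * q)"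
    using det by (simp_all add: algebra_simps)
  moreover have "?nz (p * t) (s * t) (p * q) \<or> ?nz (r * p) (r * s) (u * s) \<or>
      ?nz (t * u) (r * q) (u * q) \<or> ?sys 1 0 0 \<or> ?sys 0 1 0 \<or> ?sys 0 0 1"
    by auto
  moreover have "?nz 1 0 0" "?nz 0 1 0" "?nz 0 0 1" by auto
  ultimately show "\<exists>a b c. ?nz a b c \<and> ?sys a b c" by metis
qed

lemma index_pairs:
  fixes i j :: nat
  shows "1 \<le> i \<and> i < j \<and> j \<le> 4 \<longleftrightarrow>
    (i, j) \<in> {(1, 2), (1, 3), (1, 4), (2, 3), (2, 4), (3, 4)}"
  by auto

lemma all_index_pairs:
  fixes P :: "nat \<Rightarrow> nat \<Rightarrow> bool"
  shows "(\<forall>i j. 1 \<le> i \<and> i < j \<and> j \<le> 4 \<longrightarrow> P i j) \<longleftrightarrow>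
    P 1 2 \<and> P 1 3 \<and> P 1 4 \<and> P 2 3 \<and> P 2 4 \<and> P 3 4"
  unfolding index_pairs by auto

lemma ex_index_pairs:
  fixes P :: "nat \<Rightarrow> nat \<Rightarrow> bool"
  shows "(\<exists>i j. 1 \<le> i \<and> i < j \<and> j \<le> 4 \<and> P i j) \<longleftrightarrow>
    P 1 2 \<or> P 1 3 \<or> P 1 4 \<or> P 2 3 \<or> P 2 4 \<or> P 3 4"
  using all_index_pairs[of "\<lambda>i j. \<not> P i j"] by blast

text \<open>Every monomial of \<open>det_S2\<close> contains exactly one coordinate of each of the
  six vectors.\<close>

lemma det_S2_eq_0_if_zero_vector:
  assumes "1 \<le> i \<and> i < j \<and> j \<le> 4" "v i j = 0"
  shows "det_S2 v = 0"
  using assms unfolding index_pairs by (auto simp: det_S2_def)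

theorem theorem4p2:
  fixes v :: "nat \<Rightarrow> nat \<Rightarrow> real^2"
  shows "det_S2 v = 0 \<longleftrightarrow>
    (\<exists>(Q :: nat \<Rightarrow> real^2) (lam :: nat \<Rightarrow> nat \<Rightarrow> real).
       (\<exists>i j. 1 \<le> i \<and> i < j \<and> j \<le> 4 \<and> lam i j \<noteq> 0) \<and>
       (\<forall>i j. 1 \<le> i \<and> i < j \<and> j \<le> 4 \<longrightarrow>
          lam i j *\<^sub>R v i j = vector_between (Q i) (Q j)))"
    (is "_ \<longleftrightarrow> ?realisable")
proof -
  let ?sys = "\<lambda>a b c. b * cross2 (v 1 3) (v 2 3) = a * cross2 (v 1 2) (v 2 3)
      \<and> c * cross2 (v 1 4) (v 2 4) = a * cross2 (v 1 2) (v 2 4)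
      \<and> c * cross2 (v 1 4) (v 3 4) = b * cross2 (v 1 3) (v 3 4)"
  have det_iff: "det_S2 v = 0 \<longleftrightarrow> (\<exists>a b c. (a \<noteq> 0 \<or> b \<noteq> 0 \<or> c \<noteq> 0) \<and> ?sys a b c)"
    unfolding triangular_system_nontrivial_iff det_S2_cross2 by auto
  show ?thesis
  proof
    assume det: "det_S2 v = 0"
    show ?realisable
    proof (cases "\<exists>i j. 1 \<le> i \<and> i < j \<and> j \<le> 4 \<and> v i j = 0")
      case True
      \<comment> \<open>All points coincide at the origin; a zero vector still admits the scalar
        1.\<close>
      then show ?thesis
        by (intro exI[of _ "\<lambda>_. 0"] exI[of _ "\<lambda>i j. if v i j = 0 then 1 else 0"])
          (auto simp: vector_between_def)
    next
      case False
      then have nz: "v 2 3 \<noteq> 0" "v 2 4 \<noteq> 0" "v 3 4 \<noteq> 0"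
        by (simp_all add: ex_index_pairs)
      from det det_iff obtain a b c where abc: "a \<noteq> 0 \<or> b \<noteq> 0 \<or> c \<noteq> 0" and sys: "?sys a b c"
        by blast
      from sys have
        "cross2 (b *\<^sub>R v 1 3 - a *\<^sub>R v 1 2) (v 2 3) = 0"
        "cross2 (c *\<^sub>R v 1 4 - a *\<^sub>R v 1 2) (v 2 4) = 0"
        "cross2 (c *\<^sub>R v 1 4 - b *\<^sub>R v 1 3) (v 3 4) = 0"
        by (simp_all add: cross2_diff_left cross2_scaleR_left)
      with nz obtain d e f where def:
        "b *\<^sub>R v 1 3 - a *\<^sub>R v 1 2 = d *\<^sub>R v 2 3"
        "c *\<^sub>R v 1 4 - a *\<^sub>R v 1 2 = e *\<^sub>R v 2 4"
        "c *\<^sub>R v 1 4 - b *\<^sub>R v 1 3 = f *\<^sub>R v 3 4"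
        by (metis parallel_if_cross2_eq_0)
      \<comment> \<open>The default value 0 places \<open>Q 1\<close> at the origin.\<close>
      define Q :: "nat \<Rightarrow> real^2" where
        "Q = (\<lambda>_. 0)(2 := a *\<^sub>R v 1 2, 3 := b *\<^sub>R v 1 3, 4 := c *\<^sub>R v 1 4)"
      define lam :: "nat \<Rightarrow> nat \<Rightarrow> real" where
        "lam = (\<lambda>_ _. 0)(1 := (\<lambda>_. 0)(2 := a, 3 := b, 4 := c),
                         2 := (\<lambda>_. 0)(3 := d, 4 := e), 3 := (\<lambda>_. f))"
      show ?thesis
        unfolding all_index_pairs ex_index_pairs
        using abc def
        by (intro exI[of _ Q] exI[of _ lam]) (auto simp: Q_def lam_def vector_between_def)
    qed
  next
    assume ?realisable
    then obtain Q :: "nat \<Rightarrow> real^2" and lam :: "nat \<Rightarrow> nat \<Rightarrow> real"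
      where ex: "\<exists>i j. 1 \<le> i \<and> i < j \<and> j \<le> 4 \<and> lam i j \<noteq> 0"
        and all: "\<And>i j. 1 \<le> i \<and> i < j \<and> j \<le> 4 \<Longrightarrow> lam i j *\<^sub>R v i j = Q j - Q i"
      by (auto simp: vector_between_def)
    \<comment> \<open>Going from \<open>Q i\<close> to \<open>Q j\<close> through \<open>Q 1\<close>
      makes the argument independent of the position of \<open>Q 1\<close>.\<close>
    have Q: "Q j - Q i = lam 1 j *\<^sub>R v 1 j - lam 1 i *\<^sub>R v 1 i" if "1 < i" "i < j" "j \<le> 4" for i j
      using all[of 1 i] all[of 1 j] that by simp
    show "det_S2 v = 0"
    proof (cases "lam 1 2 \<noteq> 0 \<or> lam 1 3 \<noteq> 0 \<or> lam 1 4 \<noteq> 0")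
      case True
      have "lam 1 j * cross2 (v 1 j) (v i j) = lam 1 i * cross2 (v 1 i) (v i j)"
        if "1 < i" "i < j" "j \<le> 4" for i j
      proof -
        have "cross2 (lam 1 j *\<^sub>R v 1 j - lam 1 i *\<^sub>R v 1 i) (v i j) = 0"
          using all[of i j] Q[of i j] that cross2_scaleR_self[of "lam i j" "v i j"] by simp
        then show ?thesis
          by (simp add: cross2_diff_left cross2_scaleR_left)
      qed
      then have "?sys (lam 1 2) (lam 1 3) (lam 1 4)" by simp
      with True show ?thesis unfolding det_iff by blast
    next
      case False
      \<comment> \<open>Now all four points coincide, so the nonzero scalar must belong to a pair
        with \<open>i > 1\<close> and forces \<open>v i j\<close> to vanish.\<close>
      from ex obtain i j where ij: "1 \<le> i \<and> i < j \<and> j \<le> 4" and "lam i j \<noteq> 0" by blast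
      with False have "1 < i" unfolding index_pairs by auto
      moreover have "lam 1 i = 0" "lam 1 j = 0"
        using False ij \<open>1 < i\<close> unfolding index_pairs by auto
      ultimately have "lam i j *\<^sub>R v i j = 0"
        using all[OF ij] Q[of i j] ij by simp
      with \<open>lam i j \<noteq> 0\<close> have "v i j = 0" by simp
      with ij show ?thesis by (rule det_S2_eq_0_if_zero_vector)
    qed
  qed
qed

end
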